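(* Let $\omega\in(0,\tfrac18)$ and let $F:(\mathbb{R}^3)^4\to\mathbb{R}^3$, $(P_{i-1},P_i,P_{i+1},P_{i+2})\mapsto P_{2i+1}$, be the odd-point insertion map of the Heisenberg four-point subdivision operator, where $P_j=(x_j,y_j,z_j)$. The Jacobian $DF$ has block form $[J_{i-1}\;J_i\;J_{i+1}\;J_{i+2}]$ with $3\times3$ blocks ($J_j$ being the derivative with respect to $P_j$) $$J_{i-1}=J_{i+2}=\begin{pmatrix}-\omega&0&0\\ 0&-\omega&0\\ \tfrac{\omega}{2}y_i&-\tfrac{\omega}{2}x_i&-\omega\end{pmatrix},$$ $$J_{i+1}=\begin{pmatrix}\tfrac12+\omega&0&0\\ 0&\tfrac12+\omega&0\\ -\tfrac12(\tfrac12+\omega)y_i&\tfrac12(\tfrac12+\omega)x_i&\tfrac12+\omega\end{pmatrix},\qquad J_i=\begin{pmatrix}\tfrac12+\omega&0&0\\ 0&\tfrac12+\omega&0\\ {A_i}&{B_i}&\tfrac12+\omega\end{pmatrix},$$ where $A_i=-\tfrac{\omega}{2}y_{i-1}+\tfrac12(\tfrac12+\omega)y_{i+1}-\tfrac{\omega}{2}y_{i+2}$ and $B_i=\tfrac{\omega}{2}x_{i-1}-\tfrac12(\tfrac12+\omega)x_{i+1}+\tfrac{\omega}{2}x_{i+2}$.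
   Context: The odd-point insertion map $F$ of the Heisenberg four-point subdivision operator sends $P_j=(x_j,y_j,z_j)$, $j=i-1,i,i+1,i+2$, to $P_{2i+1}=(X_{2i+1},Y_{2i+1},Z_{2i+1})$ with $X_{2i+1}=-\omega x_{i-1}+(\tfrac12+\omega)x_i+(\tfrac12+\omega)x_{i+1}-\omega x_{i+2}$, $Y_{2i+1}=-\omega y_{i-1}+(\tfrac12+\omega)y_i+(\tfrac12+\omega)y_{i+1}-\omega y_{i+2}$, $Z_{2i+1}=-\omega z_{i-1}+(\tfrac12+\omega)z_i+(\tfrac12+\omega)z_{i+1}-\omega z_{i+2}+R_i$, where $R_i=\tfrac12(x_ib_i-y_ia_i)$, $a_i=X_{2i+1}-x_i$, $b_i=Y_{2i+1}-y_i$. Rows of each block correspond to the output coordinates $X,Y,Z$ and columns to the input coordinates $x_j,y_j,z_j$. *)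

theory Defs
  imports "HOL-Analysis.Analysis"
begin

(* The arguments are the points P_{i-1}, P_i, P_{i+1}, P_{i+2}, in this order; components
   1, 2, 3 of a point are its coordinates x, y, z. *)
definition odd_insertion :: "real \<Rightarrow> (real^3) \<times> (real^3) \<times> (real^3) \<times> (real^3) \<Rightarrow> real^3" where
  "odd_insertion \<omega> = (\<lambda>(Pm, P0, P1, P2).
     let X = - \<omega> * Pm$1 + (1/2 + \<omega>) * P0$1 + (1/2 + \<omega>) * P1$1 - \<omega> * P2$1;
         Y = - \<omega> * Pm$2 + (1/2 + \<omega>) * P0$2 + (1/2 + \<omega>) * P1$2 - \<omega> * P2$2;
         a = X - P0$1;
         b = Y - P0$2;
         R = 1/2 * (P0$1 * b - P0$2 * a);
         Z = - \<omega> * Pm$3 + (1/2 + \<omega>) * P0$3 + (1/2 + \<omega>) * P1$3 - \<omega> * P2$3 + R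
     in vector [X, Y, Z])"

(* The action of the 3 x 12 block matrix [A B C D] on a column vector split into four blocks. *)
definition block_row ::
  "real^3^3 \<Rightarrow> real^3^3 \<Rightarrow> real^3^3 \<Rightarrow> real^3^3 \<Rightarrow>
   (real^3) \<times> (real^3) \<times> (real^3) \<times> (real^3) \<Rightarrow> real^3" where
  "block_row A B C D = (\<lambda>(u, v, w, t). A *v u + B *v v + C *v w + D *v t)"

end

theory Submission
  imports Defs
begin

text \<open>
  Write \<open>X\<close> and \<open>Y\<close> for the horizontal coordinates of the inserted point. They are linear in the
  four points, and the only nonlinear term is the Heisenberg correction
  \<open>R = (x\<^sub>0 (Y - y\<^sub>0) - y\<^sub>0 (X - x\<^sub>0)) / 2\<close>. Here the two products \<open>x\<^sub>0 y\<^sub>0\<close> cancel, so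
  \<open>R = (x\<^sub>0 Y - y\<^sub>0 X) / 2\<close>: half the planar symplectic form of the base point \<open>P\<^sub>0\<close> and the
  inserted point. By the product rule, a perturbation of \<open>P\<^sub>-\<close>, \<open>P\<^sub>1\<close> or \<open>P\<^sub>2\<close> changes \<open>R\<close> only
  through \<open>X\<close> and \<open>Y\<close>, so the first two entries in the last rows of \<open>J\<^sub>-\<close>, \<open>J\<^sub>1\<close> and \<open>J\<^sub>2\<close> form
  multiples of \<open>(-y\<^sub>0, x\<^sub>0) / 2\<close>. A perturbation of \<open>P\<^sub>0\<close> in
  addition meets \<open>Y / 2\<close> and \<open>-X / 2\<close> as coefficients; the symplectic form vanishes on the diagonal,
  so the contribution of \<open>P\<^sub>0\<close> itself to \<open>X\<close> and \<open>Y\<close> cancels, and \<open>A\<close> and \<open>B\<close> involve only the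
  other three points.

  The total derivative comes from \<open>odd_insertion_expand\<close> and coordinatewise differentiation
  (\<open>has_derivative_vector_3\<close>); the four partial derivatives are its restrictions to the
  coordinate subspaces (\<open>block_row_partial_derivatives\<close>).
\<close>

lemma has_derivative_vector_3:
  fixes f g h :: "'a::real_normed_vector \<Rightarrow> real"
  assumes "(f has_derivative f') F" "(g has_derivative g') F" "(h has_derivative h') F"
  shows "((\<lambda>x. vector [f x, g x, h x] :: real^3) has_derivative
          (\<lambda>x. vector [f' x, g' x, h' x])) F"
proof -
  \<comment> \<open>In terms of the standard basis, the vector becomes a sum to which the usual derivative rules apply.\<close>
  have basis: "(vector [a, b, c] :: real^3) =
      a *\<^sub>R axis 1 1 + b *\<^sub>R axis 2 1 + c *\<^sub>R axis 3 1" for a b c :: real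
    by (simp add: vec_eq_iff forall_3 axis_def)
  show ?thesis
    unfolding basis by (intro has_derivative_add has_derivative_scaleR_left assms)
qed

lemma matrix_vector_mult_3:
  fixes u :: "real^3"
  shows "(vector [vector [a11, a12, a13], vector [a21, a22, a23], vector [a31, a32, a33]]
            :: real^3^3) *v u =
         vector [a11 * u$1 + a12 * u$2 + a13 * u$3,
                 a21 * u$1 + a22 * u$2 + a23 * u$3,
                 a31 * u$1 + a32 * u$2 + a33 * u$3]"
  by (simp add: vec_eq_iff forall_3 matrix_vector_mult_def sum_3)

text \<open>
  The correction term is given here after cancellation of \<open>x\<^sub>0 y\<^sub>0\<close>, and the point is addressed by
  projections so that the derivative rules for compositions with linear maps apply.
\<close>

lemma odd_insertion_expand:
  "odd_insertion \<omega> p =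
     (let x = (\<lambda>i. - \<omega> * fst p $ i + (1/2 + \<omega>) * fst (snd p) $ i
                   + (1/2 + \<omega>) * fst (snd (snd p)) $ i - \<omega> * snd (snd (snd p)) $ i)
      in vector [x 1, x 2,
                 x 3 + 1/2 * (fst (snd p) $ 1 * x 2 - fst (snd p) $ 2 * x 1)])"
  by (cases p) (simp add: odd_insertion_def Let_def vec_eq_iff forall_3 field_simps)

text \<open>
  Each partial map is the composition of \<open>f\<close> with the affine embedding of one factor, whose
  derivative is the linear inclusion of that factor; the other three blocks are then applied to \<open>0\<close>.
\<close>

lemma block_row_partial_derivatives:
  assumes "(f has_derivative block_row A B C D) (at (a, b, c, d))"
  shows "((\<lambda>q. f (q, b, c, d)) has_derivative (\<lambda>h. A *v h)) (at a)"
    and "((\<lambda>q. f (a, q, c, d)) has_derivative (\<lambda>h. B *v h)) (at b)"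
    and "((\<lambda>q. f (a, b, q, d)) has_derivative (\<lambda>h. C *v h)) (at c)"
    and "((\<lambda>q. f (a, b, c, q)) has_derivative (\<lambda>h. D *v h)) (at d)"
proof -
  have "((\<lambda>q. (q, b, c, d)) has_derivative (\<lambda>h. (h, 0, 0, 0))) (at a)"
    by (auto intro!: derivative_eq_intros simp: zero_prod_def)
  from has_derivative_compose[OF this assms]
  show "((\<lambda>q. f (q, b, c, d)) has_derivative (\<lambda>h. A *v h)) (at a)"
    by (simp add: block_row_def)
  have "((\<lambda>q. (a, q, c, d)) has_derivative (\<lambda>h. (0, h, 0, 0))) (at b)"
    by (auto intro!: derivative_eq_intros simp: zero_prod_def)
  from has_derivative_compose[OF this assms]
  show "((\<lambda>q. f (a, q, c, d)) has_derivative (\<lambda>h. B *v h)) (at b)"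
    by (simp add: block_row_def)
  have "((\<lambda>q. (a, b, q, d)) has_derivative (\<lambda>h. (0, 0, h, 0))) (at c)"
    by (auto intro!: derivative_eq_intros simp: zero_prod_def)
  from has_derivative_compose[OF this assms]
  show "((\<lambda>q. f (a, b, q, d)) has_derivative (\<lambda>h. C *v h)) (at c)"
    by (simp add: block_row_def)
  have "((\<lambda>q. (a, b, c, q)) has_derivative (\<lambda>h. (0, 0, 0, h))) (at d)"
    by (auto intro!: derivative_eq_intros simp: zero_prod_def)
  from has_derivative_compose[OF this assms]
  show "((\<lambda>q. f (a, b, c, q)) has_derivative (\<lambda>h. D *v h)) (at d)"
    by (simp add: block_row_def)
qed

theorem proposition4p3:
  fixes \<omega> :: real and Pm P0 P1 P2 :: "real^3"
  assumes "0 < \<omega>" and "\<omega> < 1/8"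
  shows
    "let xm = Pm$1; ym = Pm$2; x0 = P0$1; y0 = P0$2;
         x1 = P1$1; y1 = P1$2; x2 = P2$1; y2 = P2$2;
         A = - (\<omega>/2) * ym + 1/2 * (1/2 + \<omega>) * y1 - (\<omega>/2) * y2;
         B = (\<omega>/2) * xm - 1/2 * (1/2 + \<omega>) * x1 + (\<omega>/2) * x2;
         Jm = (vector [vector [- \<omega>, 0, 0],
                       vector [0, - \<omega>, 0],
                       vector [(\<omega>/2) * y0, - (\<omega>/2) * x0, - \<omega>]] :: real^3^3);
         J0 = (vector [vector [1/2 + \<omega>, 0, 0],
                       vector [0, 1/2 + \<omega>, 0],
                       vector [A, B, 1/2 + \<omega>]] :: real^3^3);
         J1 = (vector [vector [1/2 + \<omega>, 0, 0],
                       vector [0, 1/2 + \<omega>, 0],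
                       vector [- (1/2) * (1/2 + \<omega>) * y0, 1/2 * (1/2 + \<omega>) * x0, 1/2 + \<omega>]] :: real^3^3);
         J2 = Jm
     in (odd_insertion \<omega> has_derivative block_row Jm J0 J1 J2) (at (Pm, P0, P1, P2)) \<and>
        ((\<lambda>Q. odd_insertion \<omega> (Q, P0, P1, P2)) has_derivative (\<lambda>h. Jm *v h)) (at Pm) \<and>
        ((\<lambda>Q. odd_insertion \<omega> (Pm, Q, P1, P2)) has_derivative (\<lambda>h. J0 *v h)) (at P0) \<and>
        ((\<lambda>Q. odd_insertion \<omega> (Pm, P0, Q, P2)) has_derivative (\<lambda>h. J1 *v h)) (at P1) \<and>
        ((\<lambda>Q. odd_insertion \<omega> (Pm, P0, P1, Q)) has_derivative (\<lambda>h. J2 *v h)) (at P2)"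
proof -
  define c where "c = 1/2 + \<omega>"
  define A where "A = - (\<omega>/2) * Pm$2 + 1/2 * c * P1$2 - (\<omega>/2) * P2$2"
  define B where "B = (\<omega>/2) * Pm$1 - 1/2 * c * P1$1 + (\<omega>/2) * P2$1"
  define Jm :: "real^3^3" where "Jm = vector [vector [- \<omega>, 0, 0], vector [0, - \<omega>, 0],
                       vector [(\<omega>/2) * P0$2, - (\<omega>/2) * P0$1, - \<omega>]]"
  define J0 :: "real^3^3" where "J0 = vector [vector [c, 0, 0], vector [0, c, 0], vector [A, B, c]]"
  define J1 :: "real^3^3" where "J1 = vector [vector [c, 0, 0], vector [0, c, 0],
                       vector [- (1/2) * c * P0$2, 1/2 * c * P0$1, c]]"
  define p where "p = (Pm, P0, P1, P2)"
  \<comment> \<open>\<open>l i\<close> is the four-point rule in coordinate \<open>i\<close>; being linear, it is its own derivative.\<close>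
  define l where "l i q = - \<omega> * fst q $ i + c * fst (snd q) $ i
      + c * fst (snd (snd q)) $ i - \<omega> * snd (snd (snd q)) $ i"
    for i :: 3 and q :: "(real^3) \<times> (real^3) \<times> (real^3) \<times> (real^3)"
  have l: "(l i has_derivative l i) (at p)" for i
    unfolding l_def[abs_def]
    by (intro has_derivative_add has_derivative_diff has_derivative_mult_right
        bounded_linear.has_derivative[OF bounded_linear_vec_nth]
        has_derivative_fst has_derivative_snd has_derivative_ident)
  have base: "((\<lambda>q. fst (snd q) $ i) has_derivative (\<lambda>h. fst (snd h) $ i)) (at p)"
    for i :: 3
    by (intro bounded_linear.has_derivative[OF bounded_linear_vec_nth]
        has_derivative_fst has_derivative_snd has_derivative_ident)
  have F: "odd_insertion \<omega> = (\<lambda>q. vector [l 1 q, l 2 q,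
      l 3 q + 1/2 * (fst (snd q) $ 1 * l 2 q - fst (snd q) $ 2 * l 1 q)])"
    by (simp add: fun_eq_iff odd_insertion_expand Let_def l_def c_def)
  have R: "((\<lambda>q. 1/2 * (fst (snd q) $ 1 * l 2 q - fst (snd q) $ 2 * l 1 q)) has_derivative
      (\<lambda>h. 1/2 * ((P0$1 * l 2 h + fst (snd h) $ 1 * l 2 p)
                  - (P0$2 * l 1 h + fst (snd h) $ 2 * l 1 p)))) (at p)"
    using has_derivative_mult_right[OF has_derivative_diff[OF
        has_derivative_mult[OF base[of 1] l[of 2]] has_derivative_mult[OF base[of 2] l[of 1]]],
        of "1/2"]
    by (simp add: p_def)
  have "(odd_insertion \<omega> has_derivative (\<lambda>h. vector [l 1 h, l 2 h,
      l 3 h + 1/2 * ((P0$1 * l 2 h + fst (snd h) $ 1 * l 2 p)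
                     - (P0$2 * l 1 h + fst (snd h) $ 2 * l 1 p))])) (at p)"
    unfolding F by (intro has_derivative_vector_3 has_derivative_add l R)
  \<comment> \<open>In the third coordinate the part of \<open>l 1\<close> and \<open>l 2\<close> that comes from \<open>P0\<close> enters once through \<open>h\<close> and once
    through \<open>p\<close>, with opposite signs; after cancellation the coefficients are \<open>A\<close> and \<open>B\<close>.\<close>
  moreover have "(\<lambda>h. vector [l 1 h, l 2 h,
      l 3 h + 1/2 * ((P0$1 * l 2 h + fst (snd h) $ 1 * l 2 p)
                     - (P0$2 * l 1 h + fst (snd h) $ 2 * l 1 p))]) = block_row Jm J0 J1 Jm"
    by (simp add: fun_eq_iff block_row_def Jm_def J0_def J1_def matrix_vector_mult_3
        vec_eq_iff forall_3 l_def p_def A_def B_def field_simps)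
  ultimately have "(odd_insertion \<omega> has_derivative block_row Jm J0 J1 Jm) (at (Pm, P0, P1, P2))"
    by (simp add: p_def)
  note D = this block_row_partial_derivatives[OF this]
  show ?thesis
    using D unfolding Let_def Jm_def J0_def J1_def A_def B_def c_def by blast
qed

end
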